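(* Let $P,Q$ be integers and let $(U_n(P,Q))_{n\ge 0}$ be the Lucas sequence of the first type. Suppose $P$ is odd with $P \equiv -1 \pmod 4$, $n$ is even, and $Q \equiv 0 \pmod 4$. Then $U_n(P,Q)$ is not a non-zero perfect square, i.e. there is no nonzero integer $m$ with $U_n(P,Q)=m^2$.
   Context: For fixed integers $P,Q$, the Lucas sequence of the first type is defined by $U_0(P,Q)=0$, $U_1(P,Q)=1$, and $U_n(P,Q)=P\cdot U_{n-1}(P,Q)-Q\cdot U_{n-2}(P,Q)$ for $n\ge 2$. *)

theory Defs
  imports Main "HOL-Number_Theory.Cong"
begin

fun lucas_U :: "int \<Rightarrow> int \<Rightarrow> nat \<Rightarrow> int" where
  "lucas_U P Q 0 = 0"
| "lucas_U P Q (Suc 0) = 1"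
| "lucas_U P Q (Suc (Suc n)) = P * lucas_U P Q (Suc n) - Q * lucas_U P Q n"

end

theory Submission
  imports Defs
begin

text \<open>Modulo 4 the recurrence degenerates to \<open>U\<^sub>n \<equiv> P U\<^sub>n\<^sub>-\<^sub>1\<close>, so \<open>U\<^sub>n \<equiv> (-1) ^ (n - 1)\<close> for
  \<open>n \<ge> 1\<close>; for even \<open>n > 0\<close> this is \<open>-1\<close>, which is not a square modulo 4.\<close>

lemma lucas_U_Suc_cong_power:
  assumes "[Q = 0] (mod m)"
  shows "[lucas_U P Q (Suc n) = P ^ n] (mod m)"
proof (induction n)
  case (Suc n)
  \<comment> \<open>The term two steps back is multiplied by \<open>Q\<close>, hence by 0 modulo
    \<open>m\<close>, so its residue is irrelevant and one-step induction suffices despite the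
    two-step recurrence.\<close>
  have "[P * lucas_U P Q (Suc n) - Q * lucas_U P Q n = P * P ^ n - 0 * lucas_U P Q n] (mod m)"
    by (intro cong_diff cong_mult cong_refl Suc.IH assms)
  then show ?case by simp
qed simp

text \<open>By parity of the root, a square leaves remainder 0 or 1 modulo 4, never 3.\<close>

lemma square_not_cong_minus_one_mod_4: "\<not> [(m::int)\<^sup>2 = - 1] (mod 4)"
proof (cases "even m")
  case True
  then obtain k where "m = 2 * k" ..
  then have "m\<^sup>2 = 4 * k\<^sup>2" by (simp add: power_mult_distrib)
  then show ?thesis by (simp add: cong_def)
next
  case False
  then obtain k where "m = 2 * k + 1" ..
  then have "m\<^sup>2 = 1 + 4 * (k\<^sup>2 + k)" by (simp add: power2_eq_square algebra_simps)
  then have "m\<^sup>2 mod 4 = 1" by presburger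
  then show ?thesis by (simp add: cong_def)
qed

theorem theorem3p3:
  fixes P Q :: int and n :: nat
  assumes "odd P" and "[P = -1] (mod 4)" and "even n" and "[Q = 0] (mod 4)"
  shows "\<not> (\<exists>m::int. m \<noteq> 0 \<and> lucas_U P Q n = m\<^sup>2)"
proof (cases n)
  case 0
  \<comment> \<open>Here \<open>lucas_U P Q 0 = 0\<close> is a square, but only of 0, which
    \<open>m \<noteq> 0\<close> excludes.\<close>
  then show ?thesis by simp
next
  case (Suc k)
  with \<open>even n\<close> have "odd k" by simp
  have "[lucas_U P Q n = P ^ k] (mod 4)"
    unfolding Suc by (rule lucas_U_Suc_cong_power) fact
  also have "[P ^ k = (-1) ^ k] (mod 4)"
    by (rule cong_pow) fact
  finally have "[lucas_U P Q n = -1] (mod 4)"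
    using \<open>odd k\<close> by simp
  then show ?thesis
    using square_not_cong_minus_one_mod_4 by auto
qed

end
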